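(* Let $M$ be a complete metric space and let $f\colon M\to M$ be a Lipschitz map. Assume that $M$ has infinitely many connected components and that one of them has non-empty interior. Then, for every $e\in M$, the operator $T_{f,e}\colon\mathcal F(M,e)\to\mathcal F(M,e)$ has a non-trivial invariant subspace.
   Context: $\mathbb K$ denotes $\mathbb R$ or $\mathbb C$. For a metric space $M$ and $e\in M$, $\mathrm{Lip}_0(M,e)$ is the Banach space of Lipschitz functions $\varphi\colon M\to\mathbb K$ with $\varphi(e)=0$, normed by the best Lipschitz constant. For $x\in M$, $\delta(x)=\delta_e(x)\in \mathrm{Lip}_0(M,e)^*$ is the evaluation functional $\varphi\mapsto\varphi(x)$. The Lipschitz-free space with basepoint $e$ is $\mathcal F(M,e):=\overline{\mathrm{span}}\{\delta(x):x\in M\}\subset \mathrm{Lip}_0(M,e)^*$ (norm closure). For a Lipschitz map $f\colon M\to M$ (not assumed to fix $e$), $T_{f,e}\colon\mathcal F(M,e)\to\mathcal F(M,e)$ is the unique bounded linear operator with $T_{f,e}(\delta(x))=\delta(f(x))-\delta(f(e))$ for all $x\in M$. A non-trivial invariant subspace of a bounded operator $T\colon X\to X$ is a closed linear subspace $S$ with $\{0\}\subsetneq S\subsetneq X$ and $T(S)\subset S$. *)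

theory Defs
  imports "HOL-Analysis.Analysis" "HOL-Library.Function_Algebras"
begin

text \<open>
  The scalars \<open>'k\<close> range over the class \<^class>\<open>real_normed_field\<close>, so that the definitions can be
  used both at \<^typ>\<open>real\<close> and at \<^typ>\<open>complex\<close>. Spaces depending on a base point are sets rather than
  types. Functionals on \<open>Lip0 e\<close> are total functions on \<open>'a \<Rightarrow> 'k\<close> that vanish outside \<open>Lip0 e\<close>, so
  that two functionals are equal in HOL iff they agree on \<open>Lip0 e\<close>.
\<close>

definition fscale :: "'k::real_normed_field \<Rightarrow> ('b \<Rightarrow> 'k) \<Rightarrow> ('b \<Rightarrow> 'k)" where
  "fscale c g = (\<lambda>x. c * g x)"

lemma fscale_apply [simp]: "fscale c g x = c * g x"
  by (simp add: fscale_def)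

interpretation fs: vector_space "fscale :: 'k::real_normed_field \<Rightarrow> ('b \<Rightarrow> 'k) \<Rightarrow> ('b \<Rightarrow> 'k)"
  by unfold_locales (auto simp: fun_eq_iff algebra_simps)

definition Lip0 :: "'a::metric_space \<Rightarrow> ('a \<Rightarrow> 'k::real_normed_field) set" where
  "Lip0 e = {\<phi>. \<phi> e = 0 \<and> (\<exists>L. L-lipschitz_on UNIV \<phi>)}"

definition lip_norm :: "('a::metric_space \<Rightarrow> 'k::real_normed_field) \<Rightarrow> real" where
  "lip_norm \<phi> = Inf {L. L-lipschitz_on UNIV \<phi>}"

definition Lip0_dual :: "'a::metric_space \<Rightarrow> (('a \<Rightarrow> 'k::real_normed_field) \<Rightarrow> 'k) set" where
  "Lip0_dual e = {\<mu>. (\<forall>\<phi>. \<phi> \<notin> Lip0 e \<longrightarrow> \<mu> \<phi> = 0) \<and>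
     (\<forall>\<phi>\<in>Lip0 e. \<forall>\<psi>\<in>Lip0 e. \<mu> (\<phi> + \<psi>) = \<mu> \<phi> + \<mu> \<psi>) \<and>
     (\<forall>c. \<forall>\<phi>\<in>Lip0 e. \<mu> (fscale c \<phi>) = c * \<mu> \<phi>) \<and>
     (\<exists>C. \<forall>\<phi>\<in>Lip0 e. norm (\<mu> \<phi>) \<le> C * lip_norm \<phi>)}"

definition dual_norm :: "'a::metric_space \<Rightarrow> (('a \<Rightarrow> 'k::real_normed_field) \<Rightarrow> 'k) \<Rightarrow> real" where
  "dual_norm e \<mu> = (SUP \<phi>\<in>{\<phi> \<in> Lip0 e. lip_norm \<phi> \<le> 1}. norm (\<mu> \<phi>))"

text \<open>The locale \<^locale>\<open>Metric_space\<close> demands non-negativity and symmetry off the carrier, hence the guard.\<close>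

definition dual_dist ::
  "'a::metric_space \<Rightarrow> (('a \<Rightarrow> 'k::real_normed_field) \<Rightarrow> 'k) \<Rightarrow> (('a \<Rightarrow> 'k) \<Rightarrow> 'k) \<Rightarrow> real" where
  "dual_dist e \<mu> \<nu> = (if \<mu> \<in> Lip0_dual e \<and> \<nu> \<in> Lip0_dual e then dual_norm e (\<mu> - \<nu>) else 0)"

definition dual_topology :: "'a::metric_space \<Rightarrow> (('a \<Rightarrow> 'k::real_normed_field) \<Rightarrow> 'k) topology" where
  "dual_topology e = Metric_space.mtopology (Lip0_dual e) (dual_dist e)"

definition point_eval :: "'a::metric_space \<Rightarrow> 'a \<Rightarrow> (('a \<Rightarrow> 'k::real_normed_field) \<Rightarrow> 'k)" where
  "point_eval e x = (\<lambda>\<phi>. if \<phi> \<in> Lip0 e then \<phi> x else 0)"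

definition free_space :: "'a::metric_space \<Rightarrow> (('a \<Rightarrow> 'k::real_normed_field) \<Rightarrow> 'k) set" where
  "free_space e = dual_topology e closure_of fs.span (range (point_eval e))"

text \<open>
  Operators on the free space are extensional functions: this makes the operator determined by a
  Lipschitz map unique as an element of the function type (see \<open>ex1_free_operator\<close> below).
\<close>

definition bounded_operator ::
  "'a::metric_space \<Rightarrow> ((('a \<Rightarrow> 'k::real_normed_field) \<Rightarrow> 'k) \<Rightarrow> (('a \<Rightarrow> 'k) \<Rightarrow> 'k)) \<Rightarrow> bool" where
  "bounded_operator e T \<longleftrightarrow>
     T \<in> free_space e \<rightarrow>\<^sub>E free_space e \<and>
     (\<forall>\<mu>\<in>free_space e. \<forall>\<nu>\<in>free_space e. T (\<mu> + \<nu>) = T \<mu> + T \<nu>) \<and>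
     (\<forall>c. \<forall>\<mu>\<in>free_space e. T (fscale c \<mu>) = fscale c (T \<mu>)) \<and>
     (\<exists>B. \<forall>\<mu>\<in>free_space e. dual_norm e (T \<mu>) \<le> B * dual_norm e \<mu>)"

definition free_operator ::
  "('a::metric_space \<Rightarrow> 'a) \<Rightarrow> 'a \<Rightarrow> (('a \<Rightarrow> 'k::real_normed_field) \<Rightarrow> 'k) \<Rightarrow> (('a \<Rightarrow> 'k) \<Rightarrow> 'k)" where
  "free_operator f e = (THE T. bounded_operator e T \<and>
     (\<forall>x. T (point_eval e x) = point_eval e (f x) - point_eval e (f e)))"

definition nontrivial_invariant_subspace ::
  "'a::metric_space \<Rightarrow> ((('a \<Rightarrow> 'k::real_normed_field) \<Rightarrow> 'k) \<Rightarrow> (('a \<Rightarrow> 'k) \<Rightarrow> 'k))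
     \<Rightarrow> (('a \<Rightarrow> 'k) \<Rightarrow> 'k) set \<Rightarrow> bool" where
  "nontrivial_invariant_subspace e T S \<longleftrightarrow>
     fs.subspace S \<and> closedin (subtopology (dual_topology e) (free_space e)) S \<and>
     {0} \<subset> S \<and> S \<subset> free_space e \<and> T ` S \<subseteq> S"


subsection \<open>Well-definedness of the dual metric, the free space and the operator\<close>

lemma lip_norm_lipschitz:
  fixes \<phi> :: "'a::metric_space \<Rightarrow> 'k::real_normed_field"
  assumes "L-lipschitz_on UNIV \<phi>"
  shows "(lip_norm \<phi>)-lipschitz_on UNIV \<phi>"
proof (rule lipschitz_onI)
  have ne: "{L. L-lipschitz_on UNIV \<phi>} \<noteq> {}" using assms by auto
  show "0 \<le> lip_norm \<phi>" unfolding lip_norm_def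
    by (rule cInf_greatest[OF ne]) (auto dest: lipschitz_on_nonneg)
  fix x y
  show "dist (\<phi> x) (\<phi> y) \<le> lip_norm \<phi> * dist x y"
  proof (cases "x = y")
    case False
    have "dist (\<phi> x) (\<phi> y) / dist x y \<le> lip_norm \<phi>" unfolding lip_norm_def
      by (rule cInf_greatest[OF ne]) (use False in \<open>auto simp: lipschitz_on_def divide_simps\<close>)
    then show ?thesis using False by (simp add: divide_simps)
  qed simp
qed

lemma lip_norm_le:
  assumes "L-lipschitz_on UNIV \<phi>"
  shows "lip_norm \<phi> \<le> L"
  unfolding lip_norm_def
  by (rule cInf_lower) (use assms in \<open>auto intro!: bdd_belowI[of _ 0] dest: lipschitz_on_nonneg\<close>)

lemma Lip0_lipschitz: "\<phi> \<in> Lip0 e \<Longrightarrow> (lip_norm \<phi>)-lipschitz_on UNIV \<phi>"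
  by (auto simp: Lip0_def intro: lip_norm_lipschitz)

lemma lip_norm_nonneg: "\<phi> \<in> Lip0 e \<Longrightarrow> 0 \<le> lip_norm \<phi>"
  using Lip0_lipschitz lipschitz_on_nonneg by blast

lemma Lip0_norm_le:
  assumes "\<phi> \<in> Lip0 e" shows "norm (\<phi> x) \<le> lip_norm \<phi> * dist x e"
  using lipschitz_onD[OF Lip0_lipschitz[OF assms], of x e] assms by (simp add: Lip0_def dist_norm)

lemma fscale_lipschitz:
  assumes "L-lipschitz_on UNIV \<phi>" shows "(norm c * L)-lipschitz_on UNIV (fscale c \<phi>)"
proof (rule lipschitz_onI)
  fix x y
  have "dist (fscale c \<phi> x) (fscale c \<phi> y) = norm c * dist (\<phi> x) (\<phi> y)"
    by (simp add: dist_norm flip: norm_mult right_diff_distrib)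
  also have "\<dots> \<le> norm c * (L * dist x y)"
    by (intro mult_left_mono lipschitz_onD[OF assms]) auto
  finally show "dist (fscale c \<phi> x) (fscale c \<phi> y) \<le> norm c * L * dist x y" by (simp add: mult.assoc)
qed (use lipschitz_on_nonneg[OF assms] in simp)

lemma Lip0_fscale: "\<phi> \<in> Lip0 e \<Longrightarrow> fscale c \<phi> \<in> Lip0 e"
  using fscale_lipschitz by (fastforce simp: Lip0_def)

lemma Lip0_add: "\<phi> \<in> Lip0 e \<Longrightarrow> \<psi> \<in> Lip0 e \<Longrightarrow> \<phi> + \<psi> \<in> Lip0 e"
proof -
  assume "\<phi> \<in> Lip0 e" "\<psi> \<in> Lip0 e"
  then obtain L L' where "L-lipschitz_on UNIV \<phi>" "L'-lipschitz_on UNIV \<psi>" "\<phi> e = 0" "\<psi> e = 0"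
    by (auto simp: Lip0_def)
  then show ?thesis
    using lipschitz_on_add[of L UNIV \<phi> L' \<psi>] by (auto simp: Lip0_def plus_fun_def)
qed

lemma Lip0_zero: "(0 :: 'a::metric_space \<Rightarrow> 'k::real_normed_field) \<in> Lip0 e"
  and lip_norm_zero: "lip_norm (0 :: 'a \<Rightarrow> 'k) \<le> 0"
proof -
  have "0-lipschitz_on UNIV (0 :: 'a \<Rightarrow> 'k)" by (auto simp: lipschitz_on_def)
  then show "(0 :: 'a \<Rightarrow> 'k) \<in> Lip0 e" "lip_norm (0 :: 'a \<Rightarrow> 'k) \<le> 0"
    by (auto simp: Lip0_def intro: lip_norm_le)
qed

lemma Lip0_unit_ball_zero: "0 \<in> {\<phi> \<in> Lip0 e. lip_norm \<phi> \<le> 1}"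
  using Lip0_zero order_trans[OF lip_norm_zero zero_le_one] by blast

lemma dual_norm_upper:
  fixes \<mu> :: "('a::metric_space \<Rightarrow> 'k::real_normed_field) \<Rightarrow> 'k"
  assumes "\<mu> \<in> Lip0_dual e" "\<phi> \<in> Lip0 e" "lip_norm \<phi> \<le> 1"
  shows "norm (\<mu> \<phi>) \<le> dual_norm e \<mu>"
  unfolding dual_norm_def
proof (rule cSUP_upper)
  have "\<exists>C. \<forall>\<phi>\<in>Lip0 e. norm (\<mu> \<phi>) \<le> C * lip_norm \<phi>"
    using assms(1) unfolding Lip0_dual_def by blast
  then obtain C where C: "\<And>\<phi>. \<phi> \<in> Lip0 e \<Longrightarrow> norm (\<mu> \<phi>) \<le> C * lip_norm \<phi>" by blast
  show "bdd_above ((\<lambda>\<phi>. norm (\<mu> \<phi>)) ` {\<phi> \<in> Lip0 e. lip_norm \<phi> \<le> 1})"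
  proof (rule bdd_aboveI2)
    fix \<phi> :: "'a \<Rightarrow> 'k" assume "\<phi> \<in> {\<phi> \<in> Lip0 e. lip_norm \<phi> \<le> 1}"
    then have *: "norm (\<mu> \<phi>) \<le> C * lip_norm \<phi>" "0 \<le> lip_norm \<phi>" "lip_norm \<phi> \<le> 1"
      using C lip_norm_nonneg by auto
    have "C * lip_norm \<phi> \<le> \<bar>C\<bar> * lip_norm \<phi>" using * by (intro mult_right_mono) auto
    also have "\<dots> \<le> \<bar>C\<bar> * 1" using * by (intro mult_left_mono) auto
    finally show "norm (\<mu> \<phi>) \<le> \<bar>C\<bar>" using * by simp
  qed
qed (use assms in simp)

lemma dual_norm_bound:
  fixes \<mu> :: "('a::metric_space \<Rightarrow> 'k::real_normed_field) \<Rightarrow> 'k"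
  assumes "\<mu> \<in> Lip0_dual e" "\<phi> \<in> Lip0 e"
  shows "norm (\<mu> \<phi>) \<le> dual_norm e \<mu> * lip_norm \<phi>"
proof (cases "lip_norm \<phi> = 0")
  case True
  have "\<exists>C. norm (\<mu> \<phi>) \<le> C * lip_norm \<phi>"
    using assms unfolding Lip0_dual_def by blast
  then show ?thesis using True by simp
next
  case False
  then have pos: "0 < lip_norm \<phi>" using lip_norm_nonneg[OF assms(2)] by simp
  define c :: 'k where "c = of_real (inverse (lip_norm \<phi>))"
  have nc: "norm c = inverse (lip_norm \<phi>)" using pos unfolding c_def norm_of_real by simp
  have "lip_norm (fscale c \<phi>) \<le> norm c * lip_norm \<phi>"
    by (intro lip_norm_le fscale_lipschitz Lip0_lipschitz[OF assms(2)])
  then have "lip_norm (fscale c \<phi>) \<le> 1" using pos nc by simp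
  then have "norm (\<mu> (fscale c \<phi>)) \<le> dual_norm e \<mu>"
    by (intro dual_norm_upper assms Lip0_fscale)
  moreover have "\<mu> (fscale c \<phi>) = c * \<mu> \<phi>" using assms by (auto simp: Lip0_dual_def)
  ultimately have "inverse (lip_norm \<phi>) * norm (\<mu> \<phi>) \<le> dual_norm e \<mu>"
    by (simp add: norm_mult nc)
  then show ?thesis using pos by (simp add: field_simps)
qed

lemma dual_norm_le:
  fixes \<mu> :: "('a::metric_space \<Rightarrow> 'k::real_normed_field) \<Rightarrow> 'k"
  assumes "\<And>\<phi>. \<phi> \<in> Lip0 e \<Longrightarrow> norm (\<mu> \<phi>) \<le> C * lip_norm \<phi>" "0 \<le> C"
  shows "dual_norm e \<mu> \<le> C"
  unfolding dual_norm_def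
proof (rule cSUP_least)
  show "{\<phi> :: 'a \<Rightarrow> 'k. \<phi> \<in> Lip0 e \<and> lip_norm \<phi> \<le> 1} \<noteq> {}"
    using Lip0_unit_ball_zero by blast
  fix \<phi> :: "'a \<Rightarrow> 'k" assume "\<phi> \<in> {\<phi> \<in> Lip0 e. lip_norm \<phi> \<le> 1}"
  then show "norm (\<mu> \<phi>) \<le> C"
    using assms(1)[of \<phi>] mult_left_mono[of "lip_norm \<phi>" 1 C] assms(2) by auto
qed

lemma dual_norm_nonneg: "\<mu> \<in> Lip0_dual e \<Longrightarrow> 0 \<le> dual_norm e \<mu>"
  by (rule order_trans[OF norm_ge_zero dual_norm_upper[OF _ Lip0_zero order_trans[OF lip_norm_zero zero_le_one]]])

lemma Lip0_dual_add: assumes "\<mu> \<in> Lip0_dual e" "\<nu> \<in> Lip0_dual e" shows "\<mu> + \<nu> \<in> Lip0_dual e"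
proof -
  have "\<exists>C. \<forall>\<phi>\<in>Lip0 e. norm ((\<mu> + \<nu>) \<phi>) \<le> C * lip_norm \<phi>"
  proof (intro exI ballI)
    fix \<phi> :: "'a \<Rightarrow> 'b" assume "\<phi> \<in> Lip0 e"
    then show "norm ((\<mu> + \<nu>) \<phi>) \<le> (dual_norm e \<mu> + dual_norm e \<nu>) * lip_norm \<phi>"
      using dual_norm_bound[OF assms(1)] dual_norm_bound[OF assms(2)]
      by (simp add: distrib_right add_mono norm_triangle_le)
  qed
  then show ?thesis using assms unfolding Lip0_dual_def by (auto simp: algebra_simps)
qed

lemma Lip0_dual_fscale: assumes "\<mu> \<in> Lip0_dual e" shows "fscale c \<mu> \<in> Lip0_dual e"
proof -
  have "\<exists>C. \<forall>\<phi>\<in>Lip0 e. norm (fscale c \<mu> \<phi>) \<le> C * lip_norm \<phi>"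
  proof (intro exI ballI)
    fix \<phi> :: "'a \<Rightarrow> 'b" assume "\<phi> \<in> Lip0 e"
    then show "norm (fscale c \<mu> \<phi>) \<le> (norm c * dual_norm e \<mu>) * lip_norm \<phi>"
      using dual_norm_bound[OF assms] by (simp add: norm_mult mult.assoc mult_left_mono)
  qed
  then show ?thesis using assms unfolding Lip0_dual_def by (auto simp: algebra_simps)
qed

lemma Lip0_dual_zero: "0 \<in> Lip0_dual e"
  unfolding Lip0_dual_def by (auto intro!: exI[of _ 0])

lemma subspace_Lip0_dual: "fs.subspace (Lip0_dual e)"
  by (simp add: fs.subspace_def Lip0_dual_add Lip0_dual_fscale Lip0_dual_zero)

lemma Lip0_dual_diff: "\<mu> \<in> Lip0_dual e \<Longrightarrow> \<nu> \<in> Lip0_dual e \<Longrightarrow> \<mu> - \<nu> \<in> Lip0_dual e"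
  using fs.subspace_diff[OF subspace_Lip0_dual] .

lemma dual_norm_triangle:
  assumes "\<mu> \<in> Lip0_dual e" "\<nu> \<in> Lip0_dual e"
  shows "dual_norm e (\<mu> + \<nu>) \<le> dual_norm e \<mu> + dual_norm e \<nu>"
proof (rule dual_norm_le)
  fix \<phi> :: "'a \<Rightarrow> 'b" assume "\<phi> \<in> Lip0 e"
  then show "norm ((\<mu> + \<nu>) \<phi>) \<le> (dual_norm e \<mu> + dual_norm e \<nu>) * lip_norm \<phi>"
    using dual_norm_bound[OF assms(1)] dual_norm_bound[OF assms(2)]
    by (simp add: distrib_right add_mono norm_triangle_le)
qed (simp add: assms dual_norm_nonneg)

lemma dual_norm_fscale_le:
  assumes "\<mu> \<in> Lip0_dual e"
  shows "dual_norm e (fscale c \<mu>) \<le> norm c * dual_norm e \<mu>"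
proof (rule dual_norm_le)
  fix \<phi> :: "'a \<Rightarrow> 'b" assume "\<phi> \<in> Lip0 e"
  then show "norm (fscale c \<mu> \<phi>) \<le> (norm c * dual_norm e \<mu>) * lip_norm \<phi>"
    using dual_norm_bound[OF assms] by (simp add: norm_mult mult.assoc mult_left_mono)
qed (simp add: assms dual_norm_nonneg)

lemma dual_norm_eq_0:
  assumes "\<mu> \<in> Lip0_dual e" shows "dual_norm e \<mu> = 0 \<longleftrightarrow> \<mu> = 0"
proof
  assume 0: "dual_norm e \<mu> = 0"
  show "\<mu> = 0"
  proof
    fix \<phi> show "\<mu> \<phi> = 0 \<phi>"
      using dual_norm_bound[OF assms, of \<phi>] 0 assms by (cases "\<phi> \<in> Lip0 e") (auto simp: Lip0_dual_def)
  qed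
next
  assume "\<mu> = 0"
  then show "dual_norm e \<mu> = 0"
    using dual_norm_le[of e \<mu> 0] dual_norm_nonneg[OF assms] by auto
qed

lemma dual_norm_minus: "dual_norm e (\<mu> - \<nu>) = dual_norm e (\<nu> - \<mu>)"
  by (simp add: dual_norm_def norm_minus_commute)

interpretation dual: Metric_space "Lip0_dual e" "dual_dist e"
  rewrites "Metric_space.mtopology (Lip0_dual e) (dual_dist e) = dual_topology e"
  for e :: "'a::metric_space"
proof -
  show "Metric_space (Lip0_dual e) (dual_dist e :: (('a \<Rightarrow> 'b) \<Rightarrow> 'b) \<Rightarrow> _)"
  proof
    fix \<mu> \<nu> :: "('a \<Rightarrow> 'b) \<Rightarrow> 'b"
    show "0 \<le> dual_dist e \<mu> \<nu>"
      by (simp add: dual_dist_def dual_norm_nonneg Lip0_dual_diff)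
    show "dual_dist e \<mu> \<nu> = dual_dist e \<nu> \<mu>"
      by (simp add: dual_dist_def dual_norm_minus[of e \<mu> \<nu>])
  next
    fix \<mu> \<nu> :: "('a \<Rightarrow> 'b) \<Rightarrow> 'b" assume "\<mu> \<in> Lip0_dual e" "\<nu> \<in> Lip0_dual e"
    then show "dual_dist e \<mu> \<nu> = 0 \<longleftrightarrow> \<mu> = \<nu>"
      using dual_norm_eq_0[OF Lip0_dual_diff, of \<mu> e \<nu>] by (simp add: dual_dist_def)
  next
    fix \<mu> \<nu> \<xi> :: "('a \<Rightarrow> 'b) \<Rightarrow> 'b"
    assume "\<mu> \<in> Lip0_dual e" "\<nu> \<in> Lip0_dual e" "\<xi> \<in> Lip0_dual e"
    then show "dual_dist e \<mu> \<xi> \<le> dual_dist e \<mu> \<nu> + dual_dist e \<nu> \<xi>"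
      using dual_norm_triangle[OF Lip0_dual_diff[of \<mu> e \<nu>] Lip0_dual_diff[of \<nu> e \<xi>]]
      by (simp add: dual_dist_def)
  qed
qed (simp add: dual_topology_def)

lemma point_eval_dual: "point_eval e x \<in> Lip0_dual e"
proof -
  have "\<exists>C. \<forall>\<phi>\<in>Lip0 e. norm (\<phi> x) \<le> C * lip_norm \<phi>"
    using Lip0_norm_le by (metis mult.commute)
  then show ?thesis
    by (simp add: Lip0_dual_def point_eval_def Lip0_add Lip0_fscale)
qed

lemma span_point_eval_subset: "fs.span (range (point_eval e)) \<subseteq> Lip0_dual e"
  by (rule fs.span_minimal) (auto simp: point_eval_dual subspace_Lip0_dual)

lemma free_space_iff:
  "\<mu> \<in> free_space e \<longleftrightarrow> \<mu> \<in> Lip0_dual e \<and>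
     (\<forall>r>0. \<exists>\<nu>\<in>fs.span (range (point_eval e)). dual_norm e (\<mu> - \<nu>) < r)"
  using span_point_eval_subset[of e]
  unfolding free_space_def dual.metric_closure_of
  by (fastforce simp: dual_dist_def subset_iff)

lemma free_space_dual: "\<mu> \<in> free_space e \<Longrightarrow> \<mu> \<in> Lip0_dual e"
  by (simp add: free_space_iff)

lemma span_subset_free_space: "fs.span (range (point_eval e)) \<subseteq> free_space e"
  unfolding free_space_def
  by (rule closure_of_subset) (simp add: span_point_eval_subset)

lemma point_eval_free_space: "point_eval e x \<in> free_space e"
  using span_subset_free_space fs.span_base by blast

lemma subspace_free_space:
  fixes e :: "'a::metric_space"
  shows "fs.subspace (free_space e :: (('a \<Rightarrow> 'k::real_normed_field) \<Rightarrow> 'k) set)"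
proof (rule fs.subspaceI)
  show "0 \<in> free_space e" using span_subset_free_space fs.span_zero by blast
next
  fix \<mu> \<nu> :: "('a \<Rightarrow> 'k) \<Rightarrow> 'k" assume A: "\<mu> \<in> free_space e" "\<nu> \<in> free_space e"
  show "\<mu> + \<nu> \<in> free_space e" unfolding free_space_iff
  proof (intro conjI allI impI)
    show "\<mu> + \<nu> \<in> Lip0_dual e" using A by (simp add: free_space_dual Lip0_dual_add)
    fix r :: real assume "0 < r"
    then obtain \<mu>' \<nu>' where *: "\<mu>' \<in> fs.span (range (point_eval e))" "dual_norm e (\<mu> - \<mu>') < r / 2"
       "\<nu>' \<in> fs.span (range (point_eval e))" "dual_norm e (\<nu> - \<nu>') < r / 2"
      using A unfolding free_space_iff by (meson half_gt_zero)
    have "dual_norm e ((\<mu> - \<mu>') + (\<nu> - \<nu>')) \<le> dual_norm e (\<mu> - \<mu>') + dual_norm e (\<nu> - \<nu>')"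
      using A * span_subset_free_space by (intro dual_norm_triangle Lip0_dual_diff free_space_dual) blast+
    then have "dual_norm e (\<mu> + \<nu> - (\<mu>' + \<nu>')) < r" using * by (simp add: algebra_simps)
    then show "\<exists>\<xi>\<in>fs.span (range (point_eval e)). dual_norm e (\<mu> + \<nu> - \<xi>) < r"
      using * fs.span_add by blast
  qed
next
  fix c :: 'k and \<mu> :: "('a \<Rightarrow> 'k) \<Rightarrow> 'k" assume A: "\<mu> \<in> free_space e"
  show "fscale c \<mu> \<in> free_space e" unfolding free_space_iff
  proof (intro conjI allI impI)
    show "fscale c \<mu> \<in> Lip0_dual e" using A by (simp add: free_space_dual Lip0_dual_fscale)
    fix r :: real assume "0 < r"
    moreover have pos: "0 < norm c + 1" using norm_ge_zero[of c] by linarith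
    ultimately obtain \<nu> where *: "\<nu> \<in> fs.span (range (point_eval e))" "dual_norm e (\<mu> - \<nu>) < r / (norm c + 1)"
      using A unfolding free_space_iff by (meson divide_pos_pos)
    have d: "\<mu> - \<nu> \<in> Lip0_dual e"
      using A * span_subset_free_space by (intro Lip0_dual_diff free_space_dual) blast+
    have "dual_norm e (fscale c (\<mu> - \<nu>)) \<le> norm c * dual_norm e (\<mu> - \<nu>)"
      by (rule dual_norm_fscale_le[OF d])
    also have "\<dots> \<le> (norm c + 1) * dual_norm e (\<mu> - \<nu>)"
      by (intro mult_right_mono dual_norm_nonneg d) simp
    also have "\<dots> < r" using * pos by (simp add: field_simps)
    finally have "dual_norm e (fscale c \<mu> - fscale c \<nu>) < r" by (simp add: fs.scale_right_diff_distrib)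
    then show "\<exists>\<xi>\<in>fs.span (range (point_eval e)). dual_norm e (fscale c \<mu> - \<xi>) < r"
      using * fs.span_scale by blast
  qed
qed

lemma ex1_free_operator:
  fixes f :: "'a::metric_space \<Rightarrow> 'a" and e :: 'a
  assumes "\<exists>L. L-lipschitz_on UNIV f"
  shows "\<exists>!T :: (('a \<Rightarrow> 'k::real_normed_field) \<Rightarrow> 'k) \<Rightarrow> _. bounded_operator e T \<and>
    (\<forall>x. T (point_eval e x) = point_eval e (f x) - point_eval e (f e))"
proof -
  obtain L where L: "L-lipschitz_on UNIV f" using assms by blast
  have L0: "0 \<le> L" using L lipschitz_on_nonneg by blast
  define c :: "('a \<Rightarrow> 'k) \<Rightarrow> ('a \<Rightarrow> 'k)" where "c \<phi> = (\<lambda>x. \<phi> (f x) - \<phi> (f e))" for \<phi>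
  define P :: "(('a \<Rightarrow> 'k) \<Rightarrow> 'k) \<Rightarrow> (('a \<Rightarrow> 'k) \<Rightarrow> 'k)"
    where "P \<mu> = (\<lambda>\<phi>. if \<phi> \<in> Lip0 e then \<mu> (c \<phi>) else 0)" for \<mu>
  have c_lip: "(lip_norm \<phi> * L)-lipschitz_on UNIV (c \<phi>)" if "\<phi> \<in> Lip0 e" for \<phi>
  proof (rule lipschitz_onI)
    fix x y
    have "dist (c \<phi> x) (c \<phi> y) = dist (\<phi> (f x)) (\<phi> (f y))" by (simp add: c_def dist_norm)
    also have "\<dots> \<le> lip_norm \<phi> * dist (f x) (f y)"
      using lipschitz_onD[OF Lip0_lipschitz[OF that]] by simp
    also have "\<dots> \<le> lip_norm \<phi> * (L * dist x y)"
      using lipschitz_onD[OF L, of x y] lip_norm_nonneg[OF that] by (simp add: mult_left_mono)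
    finally show "dist (c \<phi> x) (c \<phi> y) \<le> lip_norm \<phi> * L * dist x y" by (simp add: mult.assoc)
  qed (use lip_norm_nonneg[OF that] L0 in simp)
  have c_Lip0: "c \<phi> \<in> Lip0 e" and c_norm: "lip_norm (c \<phi>) \<le> lip_norm \<phi> * L" if "\<phi> \<in> Lip0 e" for \<phi>
    using c_lip[OF that] by (auto simp: Lip0_def c_def intro: lip_norm_le)
  have c_add: "c (\<phi> + \<psi>) = c \<phi> + c \<psi>" and c_scale: "c (fscale a \<phi>) = fscale a (c \<phi>)" for \<phi> \<psi> a
    by (auto simp: c_def fun_eq_iff algebra_simps)
  have P_bd: "norm (P \<mu> \<phi>) \<le> (L * dual_norm e \<mu>) * lip_norm \<phi>"
    if "\<mu> \<in> Lip0_dual e" "\<phi> \<in> Lip0 e" for \<mu> \<phi>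
  proof -
    have "norm (P \<mu> \<phi>) \<le> dual_norm e \<mu> * lip_norm (c \<phi>)"
      using that dual_norm_bound[OF that(1) c_Lip0] by (simp add: P_def)
    also have "\<dots> \<le> dual_norm e \<mu> * (lip_norm \<phi> * L)"
      by (intro mult_left_mono c_norm dual_norm_nonneg that)
    finally show ?thesis by (simp add: algebra_simps)
  qed
  have P_norm: "dual_norm e (P \<mu>) \<le> L * dual_norm e \<mu>" if "\<mu> \<in> Lip0_dual e" for \<mu>
    by (rule dual_norm_le) (use that P_bd L0 dual_norm_nonneg[OF that] in auto)
  have P_dual: "P \<mu> \<in> Lip0_dual e" if "\<mu> \<in> Lip0_dual e" for \<mu>
  proof -
    have "\<exists>C. \<forall>\<phi>\<in>Lip0 e. norm (P \<mu> \<phi>) \<le> C * lip_norm \<phi>" using P_bd[OF that] by blast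
    then show ?thesis using that
      unfolding Lip0_dual_def by (simp add: P_def c_add c_scale c_Lip0 Lip0_add Lip0_fscale)
  qed
  have P_add: "P (\<mu> + \<nu>) = P \<mu> + P \<nu>" and P_diff: "P (\<mu> - \<nu>) = P \<mu> - P \<nu>"
    and P_scale: "P (fscale a \<mu>) = fscale a (P \<mu>)" for \<mu> \<nu> a
    by (auto simp: P_def fun_eq_iff)
  have P_eval: "P (point_eval e x) = point_eval e (f x) - point_eval e (f e)" for x
    using c_Lip0 by (auto simp: P_def point_eval_def fun_eq_iff c_def)
  have P_span: "P \<mu> \<in> fs.span (range (point_eval e))" if "\<mu> \<in> fs.span (range (point_eval e))" for \<mu>
    using that
  proof (induction rule: fs.span_induct_alt)
    case base
    have "P 0 = 0" by (auto simp: P_def fun_eq_iff)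
    then show ?case by (metis fs.span_zero)
  next
    case (step a x y)
    then obtain z where z: "x = point_eval e z" by blast
    have "fscale a (point_eval e (f z) - point_eval e (f e)) + P y \<in> fs.span (range (point_eval e))"
      by (intro fs.span_add fs.span_scale fs.span_diff fs.span_base rangeI step.IH)
    then show ?case by (simp only: P_add P_scale P_eval z)
  qed
  have P_free: "P \<mu> \<in> free_space e" if mu: "\<mu> \<in> free_space e" for \<mu>
    unfolding free_space_iff
  proof (intro conjI allI impI)
    show "P \<mu> \<in> Lip0_dual e" using mu by (simp add: free_space_dual P_dual)
    fix r :: real assume "0 < r"
    moreover have pos: "0 < L + 1" using L0 by linarith
    ultimately obtain \<nu> where *: "\<nu> \<in> fs.span (range (point_eval e))" "dual_norm e (\<mu> - \<nu>) < r / (L + 1)"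
      using mu unfolding free_space_iff by (meson divide_pos_pos)
    have d: "\<mu> - \<nu> \<in> Lip0_dual e"
      using mu * span_subset_free_space by (intro Lip0_dual_diff free_space_dual) blast+
    have "dual_norm e (P (\<mu> - \<nu>)) \<le> L * dual_norm e (\<mu> - \<nu>)" by (rule P_norm[OF d])
    also have "\<dots> \<le> (L + 1) * dual_norm e (\<mu> - \<nu>)"
      by (intro mult_right_mono dual_norm_nonneg d) simp
    also have "\<dots> < r" using * pos by (simp add: field_simps)
    finally show "\<exists>\<xi>\<in>fs.span (range (point_eval e)). dual_norm e (P \<mu> - \<xi>) < r"
      using P_span[OF *(1)] unfolding P_diff by blast
  qed
  define T where "T = restrict P (free_space e)"
  show ?thesis
  proof (rule ex1I)
    have "\<exists>B. \<forall>\<mu>\<in>free_space e. dual_norm e (T \<mu>) \<le> B * dual_norm e \<mu>"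
      using P_norm free_space_dual by (auto simp: T_def)
    then show "bounded_operator e T \<and> (\<forall>x. T (point_eval e x) = point_eval e (f x) - point_eval e (f e))"
      using fs.subspace_add[OF subspace_free_space[of e]] fs.subspace_scale[OF subspace_free_space[of e]]
      by (auto simp: bounded_operator_def T_def P_free P_add P_scale P_eval point_eval_free_space)
  next
    fix U :: "(('a \<Rightarrow> 'k) \<Rightarrow> 'k) \<Rightarrow> _"
    assume U: "bounded_operator e U \<and> (\<forall>x. U (point_eval e x) = point_eval e (f x) - point_eval e (f e))"
    then obtain B where U_PiE: "U \<in> free_space e \<rightarrow>\<^sub>E free_space e"
      and U_add: "\<And>\<mu> \<nu>. \<mu> \<in> free_space e \<Longrightarrow> \<nu> \<in> free_space e \<Longrightarrow> U (\<mu> + \<nu>) = U \<mu> + U \<nu>"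
      and U_scale: "\<And>a \<mu>. \<mu> \<in> free_space e \<Longrightarrow> U (fscale a \<mu>) = fscale a (U \<mu>)"
      and U_norm: "\<And>\<mu>. \<mu> \<in> free_space e \<Longrightarrow> dual_norm e (U \<mu>) \<le> B * dual_norm e \<mu>"
      and U_eval: "\<And>x. U (point_eval e x) = point_eval e (f x) - point_eval e (f e)"
      unfolding bounded_operator_def by blast
    have zero: "0 \<in> free_space e" by (rule fs.subspace_0[OF subspace_free_space])
    have U0: "U 0 = 0" using U_add[OF zero zero] by simp
    have eq_span: "\<nu> \<in> free_space e \<and> U \<nu> = P \<nu>" if "\<nu> \<in> fs.span (range (point_eval e))" for \<nu>
      using that
    proof (induction rule: fs.span_induct_alt)
      case base
      have "P 0 = 0" by (auto simp: P_def fun_eq_iff)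
      with zero U0 show ?case by metis
    next
      case (step a x y)
      then obtain z where z: "x = point_eval e z" by blast
      have "fscale a x \<in> free_space e"
        unfolding z by (intro fs.subspace_scale[OF subspace_free_space] point_eval_free_space)
      moreover have "y \<in> free_space e" "U y = P y" using step.IH by auto
      moreover have "U (fscale a x) = P (fscale a x)"
        unfolding z P_scale U_scale[OF point_eval_free_space] U_eval P_eval ..
      ultimately have "fscale a x + y \<in> free_space e" "U (fscale a x + y) = P (fscale a x + y)"
        by (simp_all only: U_add P_add fs.subspace_add[OF subspace_free_space])
      then show ?case by (rule conjI)
    qed
    show "U = T"
    proof (rule PiE_ext[OF U_PiE])
      show "T \<in> free_space e \<rightarrow>\<^sub>E free_space e" by (auto simp: T_def P_free)
      fix \<mu> :: "('a \<Rightarrow> 'k) \<Rightarrow> 'k" assume mu: "\<mu> \<in> free_space e"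
      have dU: "U \<mu> \<in> Lip0_dual e" using mu U_PiE by (auto intro: free_space_dual)
      have dP: "P \<mu> \<in> Lip0_dual e" using mu by (auto intro: free_space_dual P_dual)
      have "dual_norm e (U \<mu> - P \<mu>) \<le> 0 + r" if "0 < r" for r
      proof -
        define K where "K = \<bar>B\<bar> + L + 1"
        have K: "0 < K" "B + L \<le> K" using L0 by (auto simp: K_def)
        obtain \<nu> where nu: "\<nu> \<in> fs.span (range (point_eval e))" "dual_norm e (\<mu> - \<nu>) < r / K"
          using mu \<open>0 < r\<close> K(1) unfolding free_space_iff by (meson divide_pos_pos)
        have nuF: "\<nu> \<in> free_space e" and UP: "U \<nu> = P \<nu>" using eq_span[OF nu(1)] by auto
        have dF: "\<mu> - \<nu> \<in> free_space e" by (rule fs.subspace_diff[OF subspace_free_space mu nuF])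
        have dD: "\<mu> - \<nu> \<in> Lip0_dual e" by (rule free_space_dual[OF dF])
        have "U \<mu> = U (\<mu> - \<nu>) + P \<nu>"
          using U_add[OF dF nuF] unfolding UP diff_add_cancel .
        then have eq: "U \<mu> - P \<mu> = U (\<mu> - \<nu>) + P (\<nu> - \<mu>)"
          by (simp only: P_diff add_diff_eq)
        have "dual_norm e (U \<mu> - P \<mu>) \<le> dual_norm e (U (\<mu> - \<nu>)) + dual_norm e (P (\<nu> - \<mu>))"
          unfolding eq
          by (rule dual_norm_triangle[OF free_space_dual[OF PiE_mem[OF U_PiE dF]]
                P_dual[OF free_space_dual[OF fs.subspace_diff[OF subspace_free_space nuF mu]]]])
        also have "\<dots> \<le> B * dual_norm e (\<mu> - \<nu>) + L * dual_norm e (\<nu> - \<mu>)"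
          by (intro add_mono U_norm dF P_norm Lip0_dual_diff free_space_dual mu nuF)
        also have "\<dots> = (B + L) * dual_norm e (\<mu> - \<nu>)"
          by (simp add: dual_norm_minus[of e \<nu> \<mu>] algebra_simps)
        also have "\<dots> \<le> K * dual_norm e (\<mu> - \<nu>)"
          by (intro mult_right_mono K(2) dual_norm_nonneg dD)
        also have "\<dots> \<le> r" using nu(2) K(1) by (simp add: field_simps)
        finally show ?thesis by simp
      qed
      then have "dual_norm e (U \<mu> - P \<mu>) \<le> 0" by (rule field_le_epsilon)
      then have "dual_norm e (U \<mu> - P \<mu>) = 0"
        using dual_norm_nonneg[OF Lip0_dual_diff[OF dU dP]] by linarith
      then have "U \<mu> = P \<mu>" using dual_norm_eq_0[OF Lip0_dual_diff[OF dU dP]] by simp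
      then show "U \<mu> = T \<mu>" using mu by (simp add: T_def)
    qed
  qed
qed

lemma free_operator:
  fixes f :: "'a::metric_space \<Rightarrow> 'a" and e :: 'a
  defines "T \<equiv> free_operator f e :: (('a \<Rightarrow> 'k::real_normed_field) \<Rightarrow> 'k) \<Rightarrow> _"
  assumes "\<exists>L. L-lipschitz_on UNIV f"
  shows "bounded_operator e T" and "T (point_eval e x) = point_eval e (f x) - point_eval e (f e)"
  using theI'[OF ex1_free_operator[OF assms(2)], of e] unfolding T_def free_operator_def by blast+

end

theory Submission
  imports Defs
begin

text \<open>
  If \<open>f\<close> maps a set \<open>A\<close> into itself, then the functionals in the free space that vanish on all
  Lipschitz functions constant on \<open>A\<close> form a closed invariant subspace, because composition with
  \<open>f\<close> preserves constancy on \<open>A\<close>. It is non-zero as soon as \<open>A\<close> has two points, and it is proper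
  as soon as \<open>A\<close> is not dense, which the distance to \<open>A\<close> detects.

  Such an \<open>A\<close> always exists. Let \<open>c\<close> be interior to its component \<open>C\<close>. If the forward orbit of
  \<open>f c\<close> avoids \<open>C\<close>, then it is not dense. If it returns to \<open>C\<close>, then finitely many components
  form a closed invariant set. Either set may be a single point, but then \<open>M\<close> contains a finite
  invariant set with two points, or \<open>c\<close> is an isolated fixed point and every orbit that avoids it
  is not dense.
\<close>

section \<open>Annihilators of the functions constant on a set\<close>

definition annihilator_of_constant_on ::
  "'a::metric_space \<Rightarrow> 'a set \<Rightarrow> (('a \<Rightarrow> 'k::real_normed_field) \<Rightarrow> 'k) set" where
  "annihilator_of_constant_on e A =
     {\<mu> \<in> Lip0_dual e. \<forall>\<phi>\<in>Lip0 e. \<phi> constant_on A \<longrightarrow> \<mu> \<phi> = 0}"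

lemma subspace_annihilator_of_constant_on: "fs.subspace (annihilator_of_constant_on e A)"
  by (auto simp: fs.subspace_def annihilator_of_constant_on_def
      Lip0_dual_add Lip0_dual_fscale Lip0_dual_zero)

text \<open>Evaluation at a fixed \<open>\<phi>\<close> is continuous for the dual norm, so a
  functional that is non-zero at a \<open>\<phi>\<close> constant on \<open>A\<close> has a whole
  ball of such functionals around it.\<close>

lemma closedin_annihilator_of_constant_on:
  fixes e :: "'a::metric_space"
  shows "closedin (dual_topology e)
    (annihilator_of_constant_on e A :: (('a \<Rightarrow> 'k::real_normed_field) \<Rightarrow> 'k) set)"
  unfolding dual.closedin_metric
proof (intro conjI allI impI)
  show "annihilator_of_constant_on e A \<subseteq> Lip0_dual e"
    by (auto simp: annihilator_of_constant_on_def)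
  fix \<mu> :: "('a \<Rightarrow> 'k) \<Rightarrow> 'k"
  assume "\<mu> \<in> Lip0_dual e - annihilator_of_constant_on e A"
  then obtain \<phi> where \<mu>: "\<mu> \<in> Lip0_dual e" and \<phi>: "\<phi> \<in> Lip0 e" "\<phi> constant_on A" "\<mu> \<phi> \<noteq> 0"
    unfolding annihilator_of_constant_on_def by blast
  \<comment> \<open>The summand 1 keeps the denominator positive without a separate case for
    \<open>lip_norm \<phi> = 0\<close>.\<close>
  define r where "r = norm (\<mu> \<phi>) / (lip_norm \<phi> + 1)"
  have l: "0 < lip_norm \<phi> + 1" using lip_norm_nonneg[OF \<phi>(1)] by linarith
  have "disjnt (annihilator_of_constant_on e A) (dual.mball e \<mu> r)"
  proof -
    have False if \<nu>: "\<nu> \<in> annihilator_of_constant_on e A" "\<nu> \<in> dual.mball e \<mu> r" for \<nu>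
    proof -
      have \<nu>D: "\<nu> \<in> Lip0_dual e" and \<nu>0: "\<nu> \<phi> = 0"
        using \<nu>(1) \<phi> by (auto simp: annihilator_of_constant_on_def)
      have lt: "dual_norm e (\<mu> - \<nu>) < r"
        using \<nu>(2) \<mu> \<nu>D by (simp add: dual.in_mball dual_dist_def)
      have "norm (\<mu> \<phi>) = norm ((\<mu> - \<nu>) \<phi>)" using \<nu>0 by simp
      also have "\<dots> \<le> dual_norm e (\<mu> - \<nu>) * lip_norm \<phi>"
        by (rule dual_norm_bound[OF Lip0_dual_diff[OF \<mu> \<nu>D] \<phi>(1)])
      also have "\<dots> \<le> dual_norm e (\<mu> - \<nu>) * (lip_norm \<phi> + 1)"
        by (intro mult_left_mono dual_norm_nonneg Lip0_dual_diff \<mu> \<nu>D) simp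
      also have "\<dots> < r * (lip_norm \<phi> + 1)" using lt l by simp
      also have "\<dots> = norm (\<mu> \<phi>)" using l by (simp add: r_def)
      finally show False by simp
    qed
    then show ?thesis unfolding disjnt_iff by blast
  qed
  moreover have "0 < r" using \<phi>(3) l by (simp add: r_def)
  ultimately show "\<exists>r>0. disjnt (annihilator_of_constant_on e A) (dual.mball e \<mu> r)" by blast
qed

section \<open>Test functions and the adjoint of the operator\<close>

text \<open>These are the separating functions: \<open>A = {u}\<close> tells \<open>u\<close> from
  any other point, and a general \<open>A\<close> tells its points from those outside its closure.
  The subtracted constant enforces the value 0 at \<open>e\<close>.\<close>

lemma Lip0_infdist:
  "(\<lambda>x. of_real (infdist x A - infdist e A) :: 'k::real_normed_field) \<in> Lip0 e"
proof -
  have "1-lipschitz_on UNIV (\<lambda>x. of_real (infdist x A - infdist e A) :: 'k)"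
    by (rule lipschitz_onI) (simp_all add: dist_norm infdist_triangle_abs norm_of_real
        del: of_real_diff flip: of_real_diff)
  then show ?thesis by (auto simp: Lip0_def)
qed

lemma Lip0_compose:
  fixes \<phi> :: "'a::metric_space \<Rightarrow> 'k::real_normed_field"
  assumes "L-lipschitz_on UNIV f" "\<phi> \<in> Lip0 e"
  shows "(\<lambda>x. \<phi> (f x) - \<phi> (f e)) \<in> Lip0 e"
proof -
  have "(lip_norm \<phi> * L)-lipschitz_on UNIV (\<lambda>x. \<phi> (f x))"
    by (rule lipschitz_on_compose2[OF assms(1) lipschitz_on_subset[OF Lip0_lipschitz[OF assms(2)]]]) simp
  then have "(lip_norm \<phi> * L)-lipschitz_on UNIV (\<lambda>x. \<phi> (f x) - \<phi> (f e))"
    by (simp add: lipschitz_on_def dist_norm)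
  then show ?thesis by (auto simp: Lip0_def)
qed

text \<open>The adjoint of the operator is composition with \<open>f\<close>, corrected by a
  constant because \<open>f\<close> need not fix \<open>e\<close>. The operator is known only
  through its values on evaluations, so the formula is checked on their span and carried over by
  density and boundedness.\<close>

lemma free_operator_apply:
  fixes f :: "'a::metric_space \<Rightarrow> 'a" and \<phi> :: "'a \<Rightarrow> 'k::real_normed_field"
  assumes f: "L-lipschitz_on UNIV f" and \<mu>: "\<mu> \<in> free_space e" and \<phi>: "\<phi> \<in> Lip0 e"
  shows "free_operator f e \<mu> \<phi> = \<mu> (\<lambda>x. \<phi> (f x) - \<phi> (f e))"
proof -
  define T where "T = (free_operator f e :: (('a \<Rightarrow> 'k) \<Rightarrow> 'k) \<Rightarrow> _)"
  define \<psi> where "\<psi> = (\<lambda>x. \<phi> (f x) - \<phi> (f e))"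
  have \<psi>: "\<psi> \<in> Lip0 e" unfolding \<psi>_def by (rule Lip0_compose[OF f \<phi>])
  have f': "\<exists>L. L-lipschitz_on UNIV f" using f by blast
  have T: "bounded_operator e T" and Teval: "\<And>x. T (point_eval e x) = point_eval e (f x) - point_eval e (f e)"
    unfolding T_def using free_operator[OF f'] by blast+
  obtain B where TF: "\<And>\<mu>. \<mu> \<in> free_space e \<Longrightarrow> T \<mu> \<in> free_space e"
    and Tadd: "\<And>\<mu> \<nu>. \<mu> \<in> free_space e \<Longrightarrow> \<nu> \<in> free_space e \<Longrightarrow> T (\<mu> + \<nu>) = T \<mu> + T \<nu>"
    and Tscale: "\<And>a \<mu>. \<mu> \<in> free_space e \<Longrightarrow> T (fscale a \<mu>) = fscale a (T \<mu>)"
    and TB: "\<And>\<mu>. \<mu> \<in> free_space e \<Longrightarrow> dual_norm e (T \<mu>) \<le> B * dual_norm e \<mu>"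
    using T unfolding bounded_operator_def by blast
  note F = subspace_free_space[of e]
  have zero: "0 \<in> free_space e" by (rule fs.subspace_0[OF F])
  have T0: "T 0 = 0" using Tadd[OF zero zero] by simp
  \<comment> \<open>Membership in the free space is part of the induction because \<open>T\<close>
    is additive only there.\<close>
  have span: "\<nu> \<in> free_space e \<and> T \<nu> \<phi> = \<nu> \<psi>" if "\<nu> \<in> fs.span (range (point_eval e))" for \<nu>
    using that
  proof (induction rule: fs.span_induct_alt)
    case base
    show ?case by (metis zero T0 zero_fun_apply)
  next
    case (step a x y)
    then obtain z where z: "x = point_eval e z" by blast
    have x: "x \<in> free_space e" and ax: "fscale a x \<in> free_space e"
      unfolding z by (intro fs.subspace_scale[OF F] point_eval_free_space)+
    have "T x \<phi> = x \<psi>"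
      unfolding z Teval using \<phi> \<psi> by (simp add: point_eval_def \<psi>_def)
    moreover have y: "y \<in> free_space e" "T y \<phi> = y \<psi>" using step.IH by blast+
    ultimately have "T (fscale a x + y) \<phi> = (fscale a x + y) \<psi>"
      unfolding Tadd[OF ax y(1)] Tscale[OF x] by simp
    then show ?case by (intro conjI fs.subspace_add[OF F] ax y(1))
  qed
  have "norm (T \<mu> \<phi> - \<mu> \<psi>) \<le> 0 + r" if r: "0 < r" for r
  proof -
    \<comment> \<open>\<open>K\<close> bounds the errors of both sides together;
      \<open>\<bar>B\<bar>\<close> is there because \<open>B\<close> may be negative, the summand 1
      to make \<open>K\<close> positive.\<close>
    define K where "K = \<bar>B\<bar> * lip_norm \<phi> + lip_norm \<psi> + 1"
    have K: "0 < K" using lip_norm_nonneg[OF \<phi>] lip_norm_nonneg[OF \<psi>] by (simp add: K_def add_nonneg_pos)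
    obtain \<nu> where \<nu>: "\<nu> \<in> fs.span (range (point_eval e))" "dual_norm e (\<mu> - \<nu>) < r / K"
      using \<mu> r K unfolding free_space_iff by (meson divide_pos_pos)
    have \<nu>F: "\<nu> \<in> free_space e" and \<nu>eq: "T \<nu> \<phi> = \<nu> \<psi>" using span[OF \<nu>(1)] by auto
    have d: "\<mu> - \<nu> \<in> free_space e" by (rule fs.subspace_diff[OF F \<mu> \<nu>F])
    have nn: "0 \<le> dual_norm e (\<mu> - \<nu>)" by (intro dual_norm_nonneg free_space_dual d)
    have "T \<mu> = T (\<mu> - \<nu>) + T \<nu>" using Tadd[OF d \<nu>F] by simp
    then have "T \<mu> \<phi> - \<mu> \<psi> = T (\<mu> - \<nu>) \<phi> - (\<mu> - \<nu>) \<psi>" using \<nu>eq by simp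
    also have "norm \<dots> \<le> norm (T (\<mu> - \<nu>) \<phi>) + norm ((\<mu> - \<nu>) \<psi>)" by (rule norm_triangle_ineq4)
    also have "\<dots> \<le> dual_norm e (T (\<mu> - \<nu>)) * lip_norm \<phi> + dual_norm e (\<mu> - \<nu>) * lip_norm \<psi>"
      by (intro add_mono dual_norm_bound free_space_dual TF d \<phi> \<psi>)
    also have "\<dots> \<le> (\<bar>B\<bar> * dual_norm e (\<mu> - \<nu>)) * lip_norm \<phi> + dual_norm e (\<mu> - \<nu>) * lip_norm \<psi>"
      using order_trans[OF TB[OF d] mult_right_mono[OF abs_ge_self[of B] nn]] lip_norm_nonneg[OF \<phi>]
      by (intro add_right_mono mult_right_mono) auto
    also have "\<dots> \<le> K * dual_norm e (\<mu> - \<nu>)" using nn by (simp add: K_def algebra_simps)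
    also have "\<dots> \<le> r" using \<nu>(2) K by (simp add: field_simps)
    finally show ?thesis by simp
  qed
  then have "norm (T \<mu> \<phi> - \<mu> \<psi>) \<le> 0" by (rule field_le_epsilon)
  then show ?thesis by (simp add: T_def \<psi>_def)
qed

section \<open>From an invariant set to an invariant subspace\<close>

lemma nontrivial_invariant_subspace_annihilator:
  fixes f :: "'a::metric_space \<Rightarrow> 'a"
  assumes f: "L-lipschitz_on UNIV f"
    and A: "f ` A \<subseteq> A" "u \<in> A" "v \<in> A" "u \<noteq> v" "closure A \<noteq> UNIV"
  shows "nontrivial_invariant_subspace e
    (free_operator f e :: (('a \<Rightarrow> 'k::real_normed_field) \<Rightarrow> 'k) \<Rightarrow> _)
    (free_space e \<inter> annihilator_of_constant_on e A)"
  unfolding nontrivial_invariant_subspace_def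
proof (intro conjI)
  define S :: "(('a \<Rightarrow> 'k) \<Rightarrow> 'k) set" where "S = free_space e \<inter> annihilator_of_constant_on e A"
  show sub: "fs.subspace (free_space e \<inter> annihilator_of_constant_on e A :: (('a \<Rightarrow> 'k) \<Rightarrow> 'k) set)"
    by (rule fs.subspace_inter[OF subspace_free_space subspace_annihilator_of_constant_on])
  show "closedin (subtopology (dual_topology e) (free_space e))
      (free_space e \<inter> annihilator_of_constant_on e A :: (('a \<Rightarrow> 'k) \<Rightarrow> 'k) set)"
    by (rule closedin_subtopology_Int_closed[OF closedin_annihilator_of_constant_on])
  have diff_F: "point_eval e x - point_eval e y \<in> (free_space e :: (('a \<Rightarrow> 'k) \<Rightarrow> 'k) set)" for x y
    by (intro fs.subspace_diff[OF subspace_free_space] point_eval_free_space)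
  have diff_apply: "(point_eval e x - point_eval e y) \<phi> = \<phi> x - \<phi> y"
    if "\<phi> \<in> Lip0 e" for x y and \<phi> :: "'a \<Rightarrow> 'k"
    using that by (simp add: point_eval_def)
  have "(point_eval e u - point_eval e v) \<phi> = 0" if "\<phi> \<in> Lip0 e" "\<phi> constant_on A" for \<phi> :: "'a \<Rightarrow> 'k"
    unfolding diff_apply[OF that(1)] using that(2) A(2,3) by (auto simp: constant_on_def)
  then have "point_eval e u - point_eval e v \<in> S"
    unfolding S_def annihilator_of_constant_on_def using diff_F free_space_dual[OF diff_F] by blast
  \<comment> \<open>The two values differ by the distance from \<open>v\<close> to
    \<open>u\<close>.\<close>
  moreover have "(point_eval e u - point_eval e v) (\<lambda>x. of_real (infdist x {u} - infdist e {u})) \<noteq> (0 :: 'k)"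
    unfolding diff_apply[OF Lip0_infdist] using A(4) by (simp flip: of_real_diff)
  ultimately have "S \<noteq> {0}" by fastforce
  then show "{0} \<subset> (free_space e \<inter> annihilator_of_constant_on e A :: (('a \<Rightarrow> 'k) \<Rightarrow> 'k) set)"
    using fs.subspace_0[OF sub] by (auto simp: S_def)
  obtain w where w: "w \<notin> closure A" using A(5) by blast
  have "infdist w A \<noteq> 0" using w A(2) in_closure_iff_infdist_zero[of A w] by blast
  \<comment> \<open>The distance to \<open>A\<close> is constant on \<open>A\<close> but takes
    another value at \<open>w\<close>, so this difference of evaluations lies outside
    \<open>S\<close>.\<close>
  then have "(point_eval e w - point_eval e u) (\<lambda>x. of_real (infdist x A - infdist e A)) \<noteq> (0 :: 'k)"
    unfolding diff_apply[OF Lip0_infdist] using A(2) by simp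
  moreover have "(\<lambda>x. of_real (infdist x A - infdist e A) :: 'k) constant_on A"
    by (auto simp: constant_on_def)
  ultimately have "point_eval e w - point_eval e u \<notin> S"
    using Lip0_infdist unfolding S_def annihilator_of_constant_on_def by blast
  then show "free_space e \<inter> annihilator_of_constant_on e A \<subset> (free_space e :: (('a \<Rightarrow> 'k) \<Rightarrow> 'k) set)"
    using diff_F by (auto simp: S_def)
  have T: "free_operator f e \<mu> \<in> free_space e" if "\<mu> \<in> free_space e" for \<mu> :: "('a \<Rightarrow> 'k) \<Rightarrow> 'k"
  proof -
    have "bounded_operator e (free_operator f e :: (('a \<Rightarrow> 'k) \<Rightarrow> 'k) \<Rightarrow> _)"
      using f by (intro free_operator(1) exI)
    then show ?thesis using that by (auto simp: bounded_operator_def)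
  qed
  show "free_operator f e ` (free_space e \<inter> annihilator_of_constant_on e A)
      \<subseteq> (free_space e \<inter> annihilator_of_constant_on e A :: (('a \<Rightarrow> 'k) \<Rightarrow> 'k) set)"
  proof (rule image_subsetI)
    fix \<mu> :: "('a \<Rightarrow> 'k) \<Rightarrow> 'k" assume \<mu>: "\<mu> \<in> free_space e \<inter> annihilator_of_constant_on e A"
    have "free_operator f e \<mu> \<phi> = 0" if \<phi>: "\<phi> \<in> Lip0 e" "\<phi> constant_on A" for \<phi> :: "'a \<Rightarrow> 'k"
    proof -
      have "(\<lambda>x. \<phi> (f x) - \<phi> (f e)) constant_on A"
        using \<phi>(2) A(1) unfolding constant_on_def by (metis image_subset_iff)
      then show ?thesis
        using \<mu> Lip0_compose[OF f \<phi>(1)] free_operator_apply[OF f _ \<phi>(1), of \<mu>]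
        by (simp add: annihilator_of_constant_on_def)
    qed
    moreover have "free_operator f e \<mu> \<in> free_space e" using \<mu> T by blast
    ultimately show "free_operator f e \<mu> \<in> free_space e \<inter> annihilator_of_constant_on e A"
      using free_space_dual unfolding annihilator_of_constant_on_def by blast
  qed
qed

section \<open>Existence of a non-dense invariant set\<close>

lemma image_connected_component_subset:
  assumes "continuous_on UNIV f"
  shows "f ` connected_component_set UNIV x \<subseteq> connected_component_set UNIV (f x)"
  by (rule connected_component_maximal)
    (auto intro: connected_continuous_image continuous_on_subset[OF assms])

lemma ex_nondense_invariant_set:
  fixes f :: "'a::metric_space \<Rightarrow> 'a"
  assumes f: "continuous_on UNIV f"
    and inf: "infinite (components (UNIV :: 'a set))"
    and C: "C \<in> components (UNIV :: 'a set)" "c \<in> interior C"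
  obtains A u v where "f ` A \<subseteq> A" "u \<in> A" "v \<in> A" "u \<noteq> v" "closure A \<noteq> UNIV"
proof -
  note invariant = that
  have inf_UNIV: "infinite (UNIV :: 'a set)"
    using inf unfolding components_def by (metis finite_imageI)
  \<comment> \<open>A finite set is closed, hence not dense in the infinite space \<open>M\<close>.
    This settles the degenerate cases.\<close>
  have finite_case: thesis if "finite A" "f ` A \<subseteq> A" "u \<in> A" "v \<in> A" "u \<noteq> v" for A u v
  proof -
    have "closure A \<noteq> UNIV" using finite_imp_closed[OF that(1)] that(1) inf_UNIV by auto
    then show thesis by (rule invariant[OF that(2-5)])
  qed
  define orbit where "orbit x = range (\<lambda>n. (f ^^ n) x)" for x
  have orbit_inv: "f ` orbit x \<subseteq> orbit x" for x
    unfolding orbit_def by (auto intro: range_eqI[of _ _ "Suc _"])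
  have orbit_self: "x \<in> orbit x" for x
    unfolding orbit_def by (rule range_eqI[of _ _ 0]) simp
  have orbit_f: "f x \<in> orbit x" for x
    using orbit_inv orbit_self by blast
  \<comment> \<open>Once the orbit reaches a fixed point after \<open>n\<close> steps it stays
    there.\<close>
  have finite_orbit: "finite (orbit x)" if "f ((f ^^ n) x) = (f ^^ n) x" for n x
  proof (rule finite_subset)
    have "(f ^^ (n + m)) x = (f ^^ n) x" for m
      by (induction m) (use that in auto)
    then have "(f ^^ m) x = (f ^^ min m n) x" for m
      by (metis le_add_diff_inverse min_def nat_le_linear)
    then have "(f ^^ m) x \<in> (\<lambda>n. (f ^^ n) x) ` {..n}" for m
      by (rule image_eqI) simp
    then show "orbit x \<subseteq> (\<lambda>n. (f ^^ n) x) ` {..n}" by (auto simp: orbit_def)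
  qed simp
  have nondense: "closure A \<noteq> UNIV" if "c \<notin> closure A" for A using that by auto
  have cC: "c \<in> C" using C(2) interior_subset by blast
  have C_eq: "C = connected_component_set UNIV c"
  proof -
    obtain x where "C = connected_component_set UNIV x" using C(1) by (rule componentsE)
    then show ?thesis using cC by (simp add: connected_component_eq)
  qed
  show thesis
  proof (cases "orbit (f c) \<inter> C = {}")
    case True
    have "interior C \<inter> orbit (f c) = {}" using True interior_subset by blast
    then have "c \<notin> closure (orbit (f c))"
      using C(2) open_Int_closure_eq_empty[OF open_interior] by blast
    then have dense: "closure (orbit (f c)) \<noteq> UNIV" by (rule nondense)
    show thesis
    proof (cases "f (f c) = f c")
      \<comment> \<open>The orbit of \<open>f c\<close> is the single point \<open>f c\<close>, so
        \<open>c\<close> is added; \<open>f c\<close> differs from \<open>c\<close> since it lies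
        outside \<open>C\<close>.\<close>
      case True
      have "f c \<noteq> c" using \<open>orbit (f c) \<inter> C = {}\<close> orbit_self cC by fastforce
      then show thesis using finite_case[of "{c, f c}" c "f c"] True by auto
    next
      case False
      then show thesis using invariant[OF orbit_inv orbit_f orbit_self] dense by blast
    qed
  next
    case False
    then obtain k where k: "(f ^^ k) (f c) \<in> C" by (auto simp: orbit_def)
    \<comment> \<open>The orbit starts at \<open>f c\<close>, so its \<open>k\<close>-th term is
      iterate \<open>Suc k\<close> of \<open>c\<close>. Hence \<open>D (Suc k) = C = D 0\<close>:
      the components \<open>D 0\<close>, ..., \<open>D k\<close> are permuted into a cycle by
      \<open>f\<close>, up to inclusion, and their union is invariant.\<close>
    define D where "D n = connected_component_set UNIV ((f ^^ n) c)" for n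
    define A where "A = (\<Union>n\<le>k. D n)"
    have D_step: "f ` D n \<subseteq> D (Suc n)" for n
      using image_connected_component_subset[OF f] by (simp add: D_def)
    have "D (Suc k) = C"
      using k connected_component_eq[of "(f ^^ Suc k) c" UNIV c] C_eq
      unfolding D_def by (simp del: funpow.simps add: funpow_Suc_right)
    then have D_last: "D (Suc k) = D 0" using C_eq by (simp add: D_def)
    have A_inv: "f ` A \<subseteq> A"
    proof -
      have "f ` D n \<subseteq> A" if "n \<le> k" for n
        using D_step[of n] D_last that unfolding A_def
        by (cases "n = k") (auto intro: Suc_leI le_neq_implies_less)
      then show ?thesis by (auto simp: A_def)
    qed
    have D_comp: "D n \<in> components UNIV" for n by (auto simp: D_def components_def)
    have "closed A" unfolding A_def D_def
      by (intro closed_UN) (auto intro: closed_connected_component)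
    moreover have "A \<noteq> UNIV"
    proof
      assume U: "A = UNIV"
      \<comment> \<open>Each component would meet, and so equal, one of finitely many
        \<open>D n\<close>.\<close>
      have "components UNIV \<subseteq> D ` {..k}"
      proof
        fix E :: "'a set" assume E: "E \<in> components UNIV"
        then obtain x where x: "x \<in> E" using in_components_nonempty by fast
        have "x \<in> A" using U by simp
        then obtain n where n: "n \<le> k" "x \<in> D n" by (auto simp: A_def)
        then have "E = D n" using components_nonoverlap[OF E D_comp] x by blast
        then show "E \<in> D ` {..k}" using n by blast
      qed
      then show False using inf by (meson finite_atMost finite_surj)
    qed
    ultimately have A_nd: "closure A \<noteq> UNIV" by simp
    have C_sub: "C \<subseteq> A" using C_eq by (auto simp: A_def D_def intro: bexI[of _ 0])
    show thesis
    proof (cases "\<exists>u\<in>A. u \<noteq> c")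
      case True
      then show thesis using invariant[OF A_inv _ _ _ A_nd] C_sub cC by blast
    next
      \<comment> \<open>Now \<open>A = {c}\<close>, so \<open>c\<close> is an isolated fixed point
        and any other \<open>x\<close> may start an orbit.\<close>
      case False
      then have "C = {c}" and fc: "f c = c" using C_sub cC A_inv by blast+
      then have "interior {c} = {c}" using C(2) interior_subset[of C] by blast
      then have open_c: "open {c}" by (simp add: interior_eq)
      obtain x where x: "x \<noteq> c" using inf_UNIV ex_new_if_finite[of "{c}"] by auto
      show thesis
      proof (cases "c \<in> orbit x")
        \<comment> \<open>The orbit of \<open>x\<close> ends in the fixed point \<open>c\<close>: it
          is finite and contains both \<open>x\<close> and \<open>c\<close>.\<close>
        case True
        then obtain n where "(f ^^ n) x = c" by (auto simp: orbit_def)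
        then have "finite (orbit x)" using finite_orbit[of n x] fc by simp
        then show thesis using finite_case orbit_inv orbit_self True x by blast
      next
        case False
        then have nd: "closure (orbit x) \<noteq> UNIV"
          using open_Int_closure_eq_empty[OF open_c, of "orbit x"] by auto
        show thesis
        proof (cases "f x = x")
          \<comment> \<open>The orbit of \<open>x\<close> is a single point, so two fixed points are
            taken instead.\<close>
          case True
          then show thesis using finite_case[of "{c, x}" c x] fc x by auto
        next
          case False
          then show thesis using invariant[OF orbit_inv orbit_f orbit_self] nd by blast
        qed
      qed
    qed
  qed
qed

theorem proposition4p2:
  fixes f :: "'a::complete_space \<Rightarrow> 'a"
  assumes "\<exists>L. L-lipschitz_on UNIV f"
    and "infinite (components (UNIV :: 'a set))"
    and "\<exists>C \<in> components (UNIV :: 'a set). interior C \<noteq> {}"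
  shows "\<forall>e::'a.
    (\<exists>S. nontrivial_invariant_subspace e
       (free_operator f e :: (('a \<Rightarrow> real) \<Rightarrow> real) \<Rightarrow> (('a \<Rightarrow> real) \<Rightarrow> real)) S) \<and>
    (\<exists>S. nontrivial_invariant_subspace e
       (free_operator f e :: (('a \<Rightarrow> complex) \<Rightarrow> complex) \<Rightarrow> (('a \<Rightarrow> complex) \<Rightarrow> complex)) S)"
proof -
  obtain L where L: "L-lipschitz_on UNIV f" using assms(1) by blast
  obtain C c where "C \<in> components (UNIV :: 'a set)" "c \<in> interior C" using assms(3) by blast
  then obtain A u v where "f ` A \<subseteq> A" "u \<in> A" "v \<in> A" "u \<noteq> v" "closure A \<noteq> UNIV"
    by (rule ex_nondense_invariant_set[OF lipschitz_on_continuous_on[OF L] assms(2)])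
  \<comment> \<open>The set \<open>A\<close> depends neither on \<open>e\<close> nor on the scalars,
    so one fact serves every base point and both fields.\<close>
  note S = nontrivial_invariant_subspace_annihilator[OF L this]
  show ?thesis by (intro allI conjI exI) (rule S)+
qed

end
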